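(* Let $(X,\rho)$ be an Hadamard space, $A\colon X\to 2^{TX}$ a monotone vector field satisfying the surjectivity condition, $J_\lambda$ the resolvent of $A$ with respect to $\lambda>0$, $v$ an element in $X$, and $\{x_n\}$ a sequence defined by $x_1\in X$ and $$x_{n+1}=\alpha_nv\oplus(1-\alpha_n)J_{\lambda_n}x_n\quad(n=1,2,\dots),$$ where $\{\alpha_n\}$ is a sequence in $(0,1]$ and $\{\lambda_n\}$ is a sequence of positive real numbers such that $$\lim_{n\to\infty}\alpha_n=0,\quad\sum_{n=1}^{\infty}\alpha_n=\infty,\quad\text{and}\quad\inf_n\lambda_n>0.$$ If $\mathcal{Z}(A)$ is nonempty, then $\{x_n\}$ and $\{J_{\lambda_n}x_n\}$ are convergent (in the metric $\rho$) to $Pv$, where $P$ denotes the metric projection of $X$ onto $\mathcal{Z}(A)$.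
   Context: Geodesics and CAT(0) spaces. In a metric space $(X,\rho)$, a geodesic from $p$ to $q$ is a map $\gamma\colon[0,\rho(p,q)]\to X$ with $\gamma(0)=p$, $\gamma(\rho(p,q))=q$ and $\rho(\gamma(s),\gamma(t))=|s-t|$ for all $s,t$. $X$ is uniquely geodesic if for all $p,q\in X$ there is exactly one geodesic from $p$ to $q$, denoted $\gamma_{p,q}$; then $(1-\alpha)p\oplus\alpha q:=\gamma_{p,q}(\alpha\rho(p,q))$ for $\alpha\in[0,1]$. $X$ is a CAT(0) space if it is uniquely geodesic and $\rho((1-\alpha)x\oplus\alpha y,(1-\beta)x\oplus\beta z)\le|(1-\alpha)\bar x+\alpha\bar y-((1-\beta)\bar x+\beta\bar z)|$ whenever $\alpha,\beta\in[0,1]$, $x,y,z\in X$ and $\bar x,\bar y,\bar z\in\mathbb{R}^2$ satisfy $\rho(x,y)=|\bar x-\bar y|$, $\rho(y,z)=|\bar y-\bar z|$, $\rho(z,x)=|\bar z-\bar x|$. An Hadamard space is a complete CAT(0) space. Tangent spaces. Let $X$ be CAT(0) and $p\in X$; $\Gamma_p$ is the set of all geodesics from $p$ (i.e. all $\gamma_{p,x}$, $x\in X$). For $x,y\ne p$ the comparison angle is $\overline{\angle}_p(x,y)=\arccos\frac{\rho(p,x)^2+\rho(p,y)^2-\rho(x,y)^2}{2\rho(p,x)\rho(p,y)}$. The Alexandrov angle is $\angle_p(\gamma_{p,x},\gamma_{p,y})=\lim_{s,t\to+0}\overline{\angle}_p(\gamma_{p,x}(s),\gamma_{p,y}(t))$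 if $x\ne p$ and $y\ne p$; it is $\pi/2$ if exactly one of $x,y$ equals $p$, and $0$ if $x=y=p$. On $[0,\infty)\times\Gamma_p$ define $\tilde d_p((\alpha,\gamma_{p,x}),(\beta,\gamma_{p,y}))=\sqrt{(\alpha\rho(p,x))^2+(\beta\rho(p,y))^2-2\alpha\rho(p,x)\beta\rho(p,y)\cos\angle_p(\gamma_{p,x},\gamma_{p,y})}$, which is a pseudometric. The tangent space $T_pX$ is the quotient metric space of $[0,\infty)\times\Gamma_p$ under $(\alpha,\gamma)\sim(\beta,\eta)\iff\tilde d_p((\alpha,\gamma),(\beta,\eta))=0$, with induced metric $d_p$; the class of $(\alpha,\gamma)$ is written $\alpha\gamma$, the class of $(1,\gamma)$ is written $\gamma$, and $0_p$ is the class of $(0,\gamma_{p,p})$. Define $g_p\colon T_pX\times T_pX\to\mathbb{R}$ by $g_p(u,v)=\frac12\big(d_p(u,0_p)^2+d_p(v,0_p)^2-d_p(u,v)^2\big)$; thus $g_p(\alpha\gamma_{p,x},\beta\gamma_{p,y})=\alpha\rho(p,x)\beta\rho(p,y)\cos\angle_p(\gamma_{p,x},\gamma_{p,y})$. Monotone vector fields. $TX=\bigcup_{x\in X}T_xX$. A vector field on $X$ is a map $A\colon X\to2^{TX}$ with $Ax\subset T_xX$ for all $x$. It is monotone if $g_x(x^*,\gamma_{x,y})+g_y(y^*,\gamma_{y,x})\le0$ whenever $x,y\in X$, $x^*\in Ax$, $y^*\in Ay$. A monotone vector field satisfies the surjectivity condition if for all $\lambda>0$ and $x\in X$ there is $z\in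 X$ with $\frac1\lambda\gamma_{z,x}\in Az$. In this case the resolvent is $J_\lambda x=\{z\in X:\frac1\lambda\gamma_{z,x}\in Az\}$; this set is a singleton, and $J_\lambda$ is regarded as a map $X\to X$. $\mathcal{Z}(A)=\{u\in X:0_u\in Au\}$; it is closed and convex. Metric projection. For a nonempty closed convex subset $C$ of an Hadamard space $X$, the metric projection $P_C\colon X\to C$ sends $x$ to the unique point $\hat x\in C$ with $\rho(\hat x,x)=\min_{y\in C}\rho(y,x)$. *)

theory Defs
  imports "HOL-Analysis.Analysis"
begin

section \<open>Geodesics and Hadamard spaces\<close>

text \<open>
  A map with domain \<open>[0, dist p q]\<close> is represented by a function that is extensional
  on that interval, so that equality of HOL functions is equality of maps.
  In particular the extensional function still determines the domain of the geodesic: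
  on any nondegenerate interval a geodesic is injective, hence not constantly \<open>undefined\<close>.
\<close>

definition is_geodesic :: "'a::metric_space \<Rightarrow> 'a \<Rightarrow> (real \<Rightarrow> 'a) \<Rightarrow> bool" where
  "is_geodesic p q \<gamma> \<longleftrightarrow>
     \<gamma> \<in> extensional {0..dist p q} \<and> \<gamma> 0 = p \<and> \<gamma> (dist p q) = q \<and>
     (\<forall>s\<in>{0..dist p q}. \<forall>t\<in>{0..dist p q}. dist (\<gamma> s) (\<gamma> t) = \<bar>s - t\<bar>)"

definition geodesic :: "'a::metric_space \<Rightarrow> 'a \<Rightarrow> real \<Rightarrow> 'a" where
  "geodesic p q = (THE \<gamma>. is_geodesic p q \<gamma>)"

text \<open>\<open>geo_comb \<alpha> p q\<close> is the point \<open>(1 - \<alpha>)p \<oplus> \<alpha>q\<close>: the weight \<open>\<alpha>\<close> belongs to the second point.\<close>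

definition geo_comb :: "real \<Rightarrow> 'a::metric_space \<Rightarrow> 'a \<Rightarrow> 'a" where
  "geo_comb \<alpha> p q = geodesic p q (\<alpha> * dist p q)"

class cat0_space = metric_space +
  assumes uniquely_geodesic: "\<exists>!\<gamma>. is_geodesic p q \<gamma>"
    and cat0_inequality:
      "\<And>(x'::real^2) (y'::real^2) (z'::real^2).
         \<alpha> \<in> {0..1} \<Longrightarrow> \<beta> \<in> {0..1} \<Longrightarrow>
         dist x y = norm (x' - y') \<Longrightarrow> dist y z = norm (y' - z') \<Longrightarrow> dist z x = norm (z' - x') \<Longrightarrow>
         dist (geo_comb \<alpha> x y) (geo_comb \<beta> x z) \<le>
           norm (((1 - \<alpha>) *\<^sub>R x' + \<alpha> *\<^sub>R y') - ((1 - \<beta>) *\<^sub>R x' + \<beta> *\<^sub>R z'))"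

class hadamard_space = cat0_space + complete_space

section \<open>Tangent spaces\<close>

definition geodesics_from :: "'a::metric_space \<Rightarrow> (real \<Rightarrow> 'a) set" where
  "geodesics_from p = range (geodesic p)"

text \<open>The endpoint \<open>x\<close> of the geodesic \<open>\<gamma> = \<gamma>\<^sub>p\<^sub>,\<^sub>x\<close>, which is determined by \<open>\<gamma>\<close>.\<close>

definition geo_end :: "'a::metric_space \<Rightarrow> (real \<Rightarrow> 'a) \<Rightarrow> 'a" where
  "geo_end p \<gamma> = (THE x. \<gamma> = geodesic p x)"

definition comparison_angle :: "'a::metric_space \<Rightarrow> 'a \<Rightarrow> 'a \<Rightarrow> real" where
  "comparison_angle p x y =
     arccos (((dist p x)\<^sup>2 + (dist p y)\<^sup>2 - (dist x y)\<^sup>2) / (2 * dist p x * dist p y))"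

definition alexandrov_angle :: "'a::metric_space \<Rightarrow> (real \<Rightarrow> 'a) \<Rightarrow> (real \<Rightarrow> 'a) \<Rightarrow> real" where
  "alexandrov_angle p \<gamma> \<eta> =
     (if geo_end p \<gamma> \<noteq> p \<and> geo_end p \<eta> \<noteq> p
      then Lim (at_right 0 \<times>\<^sub>F at_right 0) (\<lambda>(s, t). comparison_angle p (\<gamma> s) (\<eta> t))
      else if geo_end p \<gamma> = p \<and> geo_end p \<eta> = p then 0
      else pi / 2)"

definition pre_tangent_dist ::
    "'a::metric_space \<Rightarrow> real \<times> (real \<Rightarrow> 'a) \<Rightarrow> real \<times> (real \<Rightarrow> 'a) \<Rightarrow> real" where
  "pre_tangent_dist p = (\<lambda>(\<alpha>, \<gamma>) (\<beta>, \<eta>).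
     let a = \<alpha> * dist p (geo_end p \<gamma>); b = \<beta> * dist p (geo_end p \<eta>)
     in sqrt (a\<^sup>2 + b\<^sup>2 - 2 * a * b * cos (alexandrov_angle p \<gamma> \<eta>)))"

definition pre_tangent :: "'a::metric_space \<Rightarrow> (real \<times> (real \<Rightarrow> 'a)) set" where
  "pre_tangent p = {0..} \<times> geodesics_from p"

definition tangent_rel ::
    "'a::metric_space \<Rightarrow> ((real \<times> (real \<Rightarrow> 'a)) \<times> (real \<times> (real \<Rightarrow> 'a))) set" where
  "tangent_rel p =
     {(a, b). a \<in> pre_tangent p \<and> b \<in> pre_tangent p \<and> pre_tangent_dist p a b = 0}"

text \<open>
  Tangent vectors are equivalence classes. Since every geodesic occurring in a class of
  \<open>tangent_space p\<close> starts at \<open>p\<close>, tangent spaces at distinct points are disjoint.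
\<close>

type_synonym 'a tangent = "(real \<times> (real \<Rightarrow> 'a)) set"

definition tangent_space :: "'a::metric_space \<Rightarrow> 'a tangent set" where
  "tangent_space p = pre_tangent p // tangent_rel p"

definition tangent_class :: "'a::metric_space \<Rightarrow> real \<Rightarrow> (real \<Rightarrow> 'a) \<Rightarrow> 'a tangent" where
  "tangent_class p \<alpha> \<gamma> = tangent_rel p `` {(\<alpha>, \<gamma>)}"

definition tangent_zero :: "'a::metric_space \<Rightarrow> 'a tangent" where
  "tangent_zero p = tangent_class p 0 (geodesic p p)"

definition tangent_dist :: "'a::metric_space \<Rightarrow> 'a tangent \<Rightarrow> 'a tangent \<Rightarrow> real" where
  "tangent_dist p u v = (THE r. \<forall>a\<in>u. \<forall>b\<in>v. pre_tangent_dist p a b = r)"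

definition tangent_inner :: "'a::metric_space \<Rightarrow> 'a tangent \<Rightarrow> 'a tangent \<Rightarrow> real" where
  "tangent_inner p u v =
     ((tangent_dist p u (tangent_zero p))\<^sup>2 + (tangent_dist p v (tangent_zero p))\<^sup>2
        - (tangent_dist p u v)\<^sup>2) / 2"

section \<open>Monotone vector fields and their resolvents\<close>

definition vector_field :: "('a::metric_space \<Rightarrow> 'a tangent set) \<Rightarrow> bool" where
  "vector_field A \<longleftrightarrow> (\<forall>x. A x \<subseteq> tangent_space x)"

definition monotone_vector_field :: "('a::metric_space \<Rightarrow> 'a tangent set) \<Rightarrow> bool" where
  "monotone_vector_field A \<longleftrightarrow> vector_field A \<and>
     (\<forall>x y. \<forall>x'\<in>A x. \<forall>y'\<in>A y.
        tangent_inner x x' (tangent_class x 1 (geodesic x y)) +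
        tangent_inner y y' (tangent_class y 1 (geodesic y x)) \<le> 0)"

definition resolvent_set ::
    "('a::metric_space \<Rightarrow> 'a tangent set) \<Rightarrow> real \<Rightarrow> 'a \<Rightarrow> 'a set" where
  "resolvent_set A \<mu> x = {z. tangent_class z (1 / \<mu>) (geodesic z x) \<in> A z}"

definition surjectivity_condition :: "('a::metric_space \<Rightarrow> 'a tangent set) \<Rightarrow> bool" where
  "surjectivity_condition A \<longleftrightarrow>
     (\<forall>\<mu>>0. \<forall>x. \<exists>z. tangent_class z (1 / \<mu>) (geodesic z x) \<in> A z)"

text \<open>
  For a monotone vector field on a CAT(0) space satisfying the surjectivity condition and
  for \<open>\<mu> > 0\<close>, \<open>resolvent_set\<close> is a singleton; the resolvent is its element.
\<close>

definition resolvent :: "('a::metric_space \<Rightarrow> 'a tangent set) \<Rightarrow> real \<Rightarrow> 'a \<Rightarrow> 'a" where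
  "resolvent A \<mu> x = the_elem (resolvent_set A \<mu> x)"

definition zeros :: "('a::metric_space \<Rightarrow> 'a tangent set) \<Rightarrow> 'a set" where
  "zeros A = {u. tangent_zero u \<in> A u}"

definition metric_projection :: "'a::metric_space set \<Rightarrow> 'a \<Rightarrow> 'a" where
  "metric_projection C x = (THE y. y \<in> C \<and> (\<forall>z\<in>C. dist y x \<le> dist z x))"

end

theory Submission
  imports Defs
begin

text \<open>
  Alexandrov angles do not exceed comparison angles (\<open>tangent_inner_ge\<close>). Hence monotonicity of
  \<open>A\<close> yields inequalities between distances alone (\<open>monotone_vector_field_dist\<close>), and tangent
  vectors play no role afterwards: for \<open>z = J\<^sub>\<mu> x\<close> and \<open>w = J\<^sub>\<nu> y\<close>,
  \<open>(\<rho>(z,x)\<^sup>2 + \<rho>(z,w)\<^sup>2 - \<rho>(x,w)\<^sup>2) / \<mu> + (\<rho>(w,y)\<^sup>2 + \<rho>(w,z)\<^sup>2 - \<rho>(y,z)\<^sup>2) / \<nu> \<le> 0\<close>,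
  and \<open>\<rho>(z,x)\<^sup>2 + \<rho>(z,u)\<^sup>2 \<le> \<rho>(x,u)\<^sup>2\<close> for every zero \<open>u\<close>.
  To pass from \<open>A\<close> to these inequalities, the distance in a tangent space must be
  well defined on classes. This holds because it is the limit of
  \<open>\<rho>(\<gamma>(\<alpha>t), \<eta>(\<beta>t)) / t\<close> as \<open>t\<close> tends to \<open>0\<close>
  (\<open>pre_tangent_dist_tendsto\<close>), so that it satisfies the triangle inequality.

  The first inequality with \<open>x = y = v\<close> shows that the resolvents \<open>w\<^sub>k = J\<^sub>k v\<close> form a Cauchy
  sequence; its limit \<open>p\<close> is the zero nearest to \<open>v\<close> (\<open>resolvent_tendsto_nearest_zero\<close>).
  Write \<open>z\<^sub>n\<close> for the resolvent of \<open>x\<^sub>n\<close>. The same inequality for \<open>z\<^sub>n\<close> and \<open>w\<^sub>k\<close>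
  bounds \<open>\<rho>(w\<^sub>k,v)\<^sup>2 - \<rho>(z\<^sub>n,v)\<^sup>2\<close> by a multiple of \<open>\<rho>(z\<^sub>n,x\<^sub>n)\<close> that does not
  depend on \<open>n\<close>. This replaces the usual argument with weak cluster points of \<open>z\<^sub>n\<close>. Together
  with the convexity of the squared distance it gives, for \<open>s\<^sub>n = \<rho>(x\<^sub>n,p)\<^sup>2\<close> and every
  \<open>e > 0\<close>, the recursion \<open>s\<^sub>n\<^sub>+\<^sub>1 \<le> (1 - \<alpha>\<^sub>n) s\<^sub>n + \<alpha>\<^sub>n e\<close> for all large \<open>n\<close>
  (\<open>halpern_step\<close>), which forces \<open>s\<^sub>n\<close> to tend to \<open>0\<close> since the series of the \<open>\<alpha>\<^sub>n\<close> diverges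
  (\<open>recursive_inequality_tendsto_0\<close>).
\<close>

section \<open>Geodesics\<close>

lemma is_geodesic_geodesic: "is_geodesic p q (geodesic p (q::'a::cat0_space))"
  unfolding geodesic_def using uniquely_geodesic[of p q] by (rule theI')

lemma geodesic_eqI: "is_geodesic p q \<gamma> \<Longrightarrow> geodesic p (q::'a::cat0_space) = \<gamma>"
  using is_geodesic_geodesic uniquely_geodesic by blast

lemma geodesic_0 [simp]: "geodesic p (q::'a::cat0_space) 0 = p"
  using is_geodesic_geodesic[of p q] by (simp add: is_geodesic_def)

lemma geodesic_dist [simp]: "geodesic p (q::'a::cat0_space) (dist p q) = q"
  using is_geodesic_geodesic[of p q] by (simp add: is_geodesic_def)

lemma geo_comb_1 [simp]: "geo_comb 1 p (q::'a::cat0_space) = q"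
  by (simp add: geo_comb_def)

lemma dist_geodesic:
  fixes p q :: "'a::cat0_space"
  assumes "0 \<le> s" "s \<le> dist p q" "0 \<le> t" "t \<le> dist p q"
  shows "dist (geodesic p q s) (geodesic p q t) = \<bar>s - t\<bar>"
  using is_geodesic_geodesic[of p q] assms by (simp add: is_geodesic_def)

lemma dist_geodesic_start:
  fixes p q :: "'a::cat0_space"
  assumes "0 \<le> s" "s \<le> dist p q"
  shows "dist p (geodesic p q s) = s"
  using dist_geodesic[of 0 p q s] assms by simp

lemma geodesic_subsegment:
  fixes p q :: "'a::cat0_space"
  assumes "0 \<le> s" "s \<le> s'" "s' \<le> dist p q"
  shows "geodesic p (geodesic p q s') s = geodesic p q s"
proof -
  have d: "dist p (geodesic p q s') = s'"
    using assms by (intro dist_geodesic_start) auto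
  have "is_geodesic p (geodesic p q s') (restrict (geodesic p q) {0..s'})"
    unfolding is_geodesic_def d using assms by (auto simp: dist_geodesic)
  from geodesic_eqI[OF this] show ?thesis
    using assms by simp
qed

text \<open>A geodesic determines its endpoint: were it also the geodesic to a farther point, it would
  take the default value on a nondegenerate interval on which it is injective.\<close>

lemma geodesic_eq_imp_dist_le:
  fixes p x y :: "'a::cat0_space"
  assumes "geodesic p x = geodesic p y"
  shows "dist p y \<le> dist p x"
proof (rule ccontr)
  assume "\<not> ?thesis"
  then have less: "dist p x < dist p y" by simp
  define t where "t = (dist p x + dist p y) / 2"
  have t: "dist p x < t" "t < dist p y" "0 \<le> t"
    using less zero_le_dist[of p x] by (auto simp: t_def simp del: zero_le_dist)
  have ext: "geodesic p x \<in> extensional {0..dist p x}"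
    using is_geodesic_geodesic[of p x] by (simp add: is_geodesic_def)
  have "geodesic p x t = geodesic p x (dist p y)"
    using extensional_arb[OF ext, of t] extensional_arb[OF ext, of "dist p y"] t less by simp
  with assms have "dist (geodesic p y t) (geodesic p y (dist p y)) = 0" by simp
  then show False using t dist_geodesic[of t p y "dist p y"] by simp
qed

lemma geodesic_inject:
  fixes p x y :: "'a::cat0_space"
  assumes "geodesic p x = geodesic p y"
  shows "x = y"
proof -
  have "dist p x = dist p y"
    by (intro antisym geodesic_eq_imp_dist_le assms assms[symmetric])
  then show ?thesis using geodesic_dist assms by metis
qed

lemma geo_end_geodesic [simp]: "geo_end p (geodesic p x) = (x::'a::cat0_space)"
  unfolding geo_end_def by (rule the_equality) (auto dest: geodesic_inject)

section \<open>The comparison inequality in terms of distances\<close>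

lemma comparison_triangle_exists:
  fixes a b c :: real
  assumes "0 \<le> a" "0 \<le> c" "\<bar>a - c\<bar> \<le> b" "b \<le> a + c"
  obtains y z :: "real^2" where "norm y = a" "norm (y - z) = b" "norm z = c"
proof (cases "a = 0")
  case True
  define z :: "real^2" where "z = vector [c, 0]"
  have "norm z = c"
    using assms by (simp add: z_def norm_vec_def L2_set_def UNIV_2)
  moreover have "b = c" using True assms by simp
  ultimately show ?thesis using True that[of 0 z] by simp
next
  case False
  then have a: "a > 0" using assms by simp
  define h where "h = (a\<^sup>2 + c\<^sup>2 - b\<^sup>2) / (2 * a)"
  have ah: "2 * a * h = a\<^sup>2 + c\<^sup>2 - b\<^sup>2" using a by (simp add: h_def)
  have "(a - c)\<^sup>2 \<le> b\<^sup>2" using assms(3) by (metis abs_ge_zero abs_le_square_iff abs_of_nonneg order_trans)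
  moreover have "b\<^sup>2 \<le> (a + c)\<^sup>2" using assms by (intro power_mono) auto
  ultimately have "2 * a * h \<le> 2 * a * c" "2 * a * (-c) \<le> 2 * a * h"
    unfolding ah by (auto simp: power2_eq_square algebra_simps)
  then have "a * h \<le> a * c" "a * (-c) \<le> a * h" by simp_all
  then have "h \<le> c" "-c \<le> h" using a by (blast dest: mult_left_le_imp_le)+
  then have hc: "h\<^sup>2 \<le> c\<^sup>2" using assms(2) by (metis abs_le_iff abs_le_square_iff abs_of_nonneg minus_le_iff)
  define y :: "real^2" where "y = vector [a, 0]"
  define z :: "real^2" where "z = vector [h, sqrt (c\<^sup>2 - h\<^sup>2)]"
  have "norm y = a" using a by (simp add: y_def norm_vec_def L2_set_def UNIV_2)
  moreover have "norm z = c" using hc assms by (simp add: z_def norm_vec_def L2_set_def UNIV_2)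
  moreover have "norm (y - z) = b"
  proof -
    have "norm (y - z) = sqrt ((a - h)\<^sup>2 + (c\<^sup>2 - h\<^sup>2))"
      using hc by (simp add: y_def z_def norm_vec_def L2_set_def UNIV_2)
    also have "(a - h)\<^sup>2 + (c\<^sup>2 - h\<^sup>2) = b\<^sup>2"
      using ah by (simp add: power2_eq_square algebra_simps)
    also have "sqrt (b\<^sup>2) = b" using assms by simp
    finally show ?thesis .
  qed
  ultimately show ?thesis using that by blast
qed

text \<open>The comparison points are eliminated by means of the law of cosines.\<close>

lemma cat0_dist_geo_comb_le:
  fixes x y z :: "'a::cat0_space"
  assumes "\<alpha> \<in> {0..1}" "\<beta> \<in> {0..1}"
  shows "(dist (geo_comb \<alpha> x y) (geo_comb \<beta> x z))\<^sup>2 \<le>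
    \<alpha>\<^sup>2 * (dist x y)\<^sup>2 + \<beta>\<^sup>2 * (dist x z)\<^sup>2
      - \<alpha> * \<beta> * ((dist x y)\<^sup>2 + (dist x z)\<^sup>2 - (dist y z)\<^sup>2)"
proof -
  have "\<bar>dist x y - dist x z\<bar> \<le> dist y z"
    using dist_triangle[of x y z] dist_triangle[of x z y] by (simp add: dist_commute)
  moreover have "dist y z \<le> dist x y + dist x z"
    using dist_triangle[of y z x] by (simp add: dist_commute)
  ultimately obtain y' z' :: "real^2"
    where n: "norm y' = dist x y" "norm (y' - z') = dist y z" "norm z' = dist x z"
    using comparison_triangle_exists[of "dist x y" "dist x z" "dist y z"] zero_le_dist by metis
  have "dist (geo_comb \<alpha> x y) (geo_comb \<beta> x z) \<le>
      norm (((1 - \<alpha>) *\<^sub>R 0 + \<alpha> *\<^sub>R y') - ((1 - \<beta>) *\<^sub>R 0 + \<beta> *\<^sub>R z'))"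
    using assms n by (intro cat0_inequality) (auto simp: dist_commute)
  then have "(dist (geo_comb \<alpha> x y) (geo_comb \<beta> x z))\<^sup>2 \<le> (norm (\<alpha> *\<^sub>R y' - \<beta> *\<^sub>R z'))\<^sup>2"
    by (intro power_mono) auto
  also have "\<dots> = \<alpha>\<^sup>2 * (norm y')\<^sup>2 + \<beta>\<^sup>2 * (norm z')\<^sup>2 - \<alpha> * \<beta> * (2 * (y' \<bullet> z'))"
    unfolding power2_norm_eq_inner
    by (simp add: inner_diff_left inner_diff_right inner_commute power2_eq_square algebra_simps)
  also have "2 * (y' \<bullet> z') = (norm y')\<^sup>2 + (norm z')\<^sup>2 - (norm (y' - z'))\<^sup>2"
    by (simp add: dot_norm_neg)
  finally show ?thesis unfolding n .
qed

lemma cat0_convex_dist_square: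
  fixes x y w :: "'a::cat0_space"
  assumes "t \<in> {0..1}"
  shows "(dist (geo_comb t x y) w)\<^sup>2 \<le>
    (1 - t) * (dist x w)\<^sup>2 + t * (dist y w)\<^sup>2 - t * (1 - t) * (dist x y)\<^sup>2"
  using cat0_dist_geo_comb_le[of t 1 x y w] assms
  by (simp add: power2_eq_square algebra_simps)

section \<open>Alexandrov angles\<close>

text \<open>The cosine of the comparison angle at \<open>p\<close> of the points at distances \<open>s\<close> and \<open>t\<close>
  from \<open>p\<close> on the geodesics to \<open>x\<close> and \<open>y\<close>.\<close>

definition comparison_cos :: "'a::metric_space \<Rightarrow> 'a \<Rightarrow> 'a \<Rightarrow> real \<Rightarrow> real \<Rightarrow> real" where
  "comparison_cos p x y s t =
     (s\<^sup>2 + t\<^sup>2 - (dist (geodesic p x s) (geodesic p y t))\<^sup>2) / (2 * s * t)"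

lemma comparison_angle_geodesic:
  fixes p x y :: "'a::cat0_space"
  assumes "0 < s" "s \<le> dist p x" "0 < t" "t \<le> dist p y"
  shows "comparison_angle p (geodesic p x s) (geodesic p y t) = arccos (comparison_cos p x y s t)"
  using assms by (simp add: comparison_angle_def comparison_cos_def dist_geodesic_start)

lemma dist_geodesic_cos:
  assumes "0 < s" "0 < t"
  shows "(dist (geodesic p x s) (geodesic p y t))\<^sup>2 = s\<^sup>2 + t\<^sup>2 - 2 * s * t * comparison_cos p x y s t"
  using assms by (simp add: comparison_cos_def field_simps)

lemma comparison_cos_bounds:
  fixes p x y :: "'a::cat0_space"
  assumes "0 < s" "s \<le> dist p x" "0 < t" "t \<le> dist p y"
  shows "-1 \<le> comparison_cos p x y s t" "comparison_cos p x y s t \<le> 1"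
proof -
  let ?d = "dist (geodesic p x s) (geodesic p y t)"
  have s: "dist p (geodesic p x s) = s" and t: "dist p (geodesic p y t) = t"
    using assms by (auto intro: dist_geodesic_start)
  have "?d \<le> s + t"
    using dist_triangle3[of "geodesic p x s" "geodesic p y t" p] s t by simp
  then have "?d\<^sup>2 \<le> (s + t)\<^sup>2" by (intro power_mono) auto
  then show "-1 \<le> comparison_cos p x y s t"
    using assms by (simp add: comparison_cos_def field_simps power2_eq_square)
  have "\<bar>s - t\<bar> \<le> ?d"
    using dist_triangle[of p "geodesic p x s" "geodesic p y t"]
      dist_triangle[of p "geodesic p y t" "geodesic p x s"] s t by (simp add: dist_commute)
  then have "(s - t)\<^sup>2 \<le> ?d\<^sup>2"
    by (metis abs_ge_zero power2_abs power_mono)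
  then show "comparison_cos p x y s t \<le> 1"
    using assms by (simp add: comparison_cos_def field_simps power2_eq_square)
qed

lemma comparison_cos_antimono:
  fixes p x y :: "'a::cat0_space"
  assumes "0 < s" "s \<le> s'" "s' \<le> dist p x" "0 < t" "t \<le> t'" "t' \<le> dist p y"
  shows "comparison_cos p x y s' t' \<le> comparison_cos p x y s t"
proof -
  let ?c = "comparison_cos p x y s' t'"
  have pos: "0 < s'" "0 < t'" using assms by auto
  have d: "dist p (geodesic p x s') = s'" "dist p (geodesic p y t') = t'"
    using assms by (auto intro: dist_geodesic_start)
  have "geo_comb (s / s') p (geodesic p x s') = geodesic p x s"
    "geo_comb (t / t') p (geodesic p y t') = geodesic p y t"
    using assms pos by (auto simp: geo_comb_def d geodesic_subsegment)
  then have "(dist (geodesic p x s) (geodesic p y t))\<^sup>2 \<le>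
      (s / s')\<^sup>2 * s'\<^sup>2 + (t / t')\<^sup>2 * t'\<^sup>2 - s / s' * (t / t') *
        (s'\<^sup>2 + t'\<^sup>2 - (dist (geodesic p x s') (geodesic p y t'))\<^sup>2)"
    using cat0_dist_geo_comb_le[of "s / s'" "t / t'" p "geodesic p x s'" "geodesic p y t'"] assms pos
    by (simp add: d)
  also have "\<dots> = s\<^sup>2 + t\<^sup>2 - 2 * s * t * ?c"
    using pos by (simp add: comparison_cos_def power_divide)
  finally have "2 * s * t * ?c \<le> 2 * s * t * comparison_cos p x y s t"
    using dist_geodesic_cos[of s t p x y] assms by simp
  then show ?thesis using assms by simp
qed

text \<open>By monotonicity the comparison cosines converge to their supremum, as both parameters tend
  to \<open>0\<close> independently of each other.\<close>

lemma comparison_cos_tendsto: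
  fixes p x y :: "'a::cat0_space"
  assumes "x \<noteq> p" "y \<noteq> p"
  shows "((\<lambda>(s, t). comparison_cos p x y s t) \<longlongrightarrow> cos (alexandrov_angle p (geodesic p x) (geodesic p y)))
           (at_right 0 \<times>\<^sub>F at_right 0)"
    and "comparison_cos p x y (dist p x) (dist p y)
           \<le> cos (alexandrov_angle p (geodesic p x) (geodesic p y))"
proof -
  let ?F = "at_right (0::real) \<times>\<^sub>F at_right (0::real)"
  let ?S = "{0<..dist p x} \<times> {0<..dist p y}"
  let ?c = "\<lambda>(s, t). comparison_cos p x y s t"
  define L where "L = (SUP u\<in>?S. ?c u)"
  have pos: "0 < dist p x" "0 < dist p y" using assms by auto
  have ev: "\<forall>\<^sub>F u in ?F. u \<in> {0<..a} \<times> {0<..b}" if "0 < a" "0 < b" for a b :: real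
  proof -
    have "\<forall>\<^sub>F s in at_right 0. s \<in> {0<..a}" "\<forall>\<^sub>F t in at_right 0. t \<in> {0<..b}"
      using that by (auto intro: eventually_at_rightI[of 0 a] eventually_at_rightI[of 0 b])
    from eventually_prodI[OF this] show ?thesis by (simp add: mem_Times_iff)
  qed
  have bdd: "bdd_above (?c ` ?S)"
    by (rule bdd_aboveI[of _ 1]) (auto intro: comparison_cos_bounds)
  have le_L: "?c u \<le> L" if "u \<in> ?S" for u
    unfolding L_def using that bdd by (rule cSUP_upper)
  have lim: "(?c \<longlongrightarrow> L) ?F"
  proof (rule order_tendstoI)
    fix a assume "a < L"
    then obtain u where u: "u \<in> ?S" "a < ?c u"
      unfolding L_def using less_cSUP_iff[of ?S ?c a] bdd pos by auto
    have "\<forall>\<^sub>F w in ?F. w \<in> {0<..fst u} \<times> {0<..snd u}"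
      using u by (intro ev) auto
    then show "\<forall>\<^sub>F w in ?F. a < ?c w"
    proof eventually_elim
      case (elim w)
      then have "?c u \<le> ?c w" using u by (auto intro!: comparison_cos_antimono)
      with u show ?case by simp
    qed
  next
    fix a assume "L < a"
    show "\<forall>\<^sub>F w in ?F. ?c w < a"
      using ev[OF pos]
    proof eventually_elim
      case (elim w)
      then show ?case using le_L[of w] \<open>L < a\<close> by simp
    qed
  qed
  have "(dist p x, dist p y) \<in> ?S" using pos by auto
  note full = le_L[OF this]
  have "-1 \<le> L" using full comparison_cos_bounds(1)[of "dist p x" p x "dist p y" y] pos by simp
  moreover have "L \<le> 1"
    unfolding L_def using pos by (intro cSUP_least) (auto intro: comparison_cos_bounds)
  ultimately have L: "L \<in> {-1..1}" by simp
  have "((\<lambda>u. arccos (?c u)) \<longlongrightarrow> arccos L) ?F"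
  proof (rule continuous_on_tendsto_compose[OF continuous_on_arccos' lim L])
    show "\<forall>\<^sub>F u in ?F. ?c u \<in> {-1..1}"
      by (rule eventually_mono[OF ev[OF pos]]) (auto intro: comparison_cos_bounds)
  qed
  then have "((\<lambda>(s, t). comparison_angle p (geodesic p x s) (geodesic p y t)) \<longlongrightarrow> arccos L) ?F"
    by (rule Lim_transform_eventually, intro eventually_mono[OF ev[OF pos]])
       (auto simp: comparison_angle_geodesic)
  then have "Lim ?F (\<lambda>(s, t). comparison_angle p (geodesic p x s) (geodesic p y t)) = arccos L"
    by (rule tendsto_Lim[rotated]) (simp add: prod_filter_eq_bot)
  then have "cos (alexandrov_angle p (geodesic p x) (geodesic p y)) = L"
    using assms L by (simp add: alexandrov_angle_def)
  then show "(?c \<longlongrightarrow> cos (alexandrov_angle p (geodesic p x) (geodesic p y))) ?F"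
    "comparison_cos p x y (dist p x) (dist p y)
       \<le> cos (alexandrov_angle p (geodesic p x) (geodesic p y))"
    using lim full by auto
qed

section \<open>Tangent spaces\<close>

text \<open>The metric of the tangent cone is the rate at which two geodesics issuing from \<open>p\<close> diverge.
  Hence it inherits the triangle inequality from the metric of the space.\<close>

lemma pre_tangent_dist_tendsto:
  fixes p x y :: "'a::cat0_space"
  assumes "0 \<le> \<alpha>" "0 \<le> \<beta>"
  shows "((\<lambda>t. dist (geo_comb (\<alpha> * t) p x) (geo_comb (\<beta> * t) p y) / t)
    \<longlongrightarrow> pre_tangent_dist p (\<alpha>, geodesic p x) (\<beta>, geodesic p y)) (at_right 0)"
proof -
  define a where "a = \<alpha> * dist p x"
  define b where "b = \<beta> * dist p y"
  let ?\<theta> = "alexandrov_angle p (geodesic p x) (geodesic p y)"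
  let ?f = "\<lambda>t. dist (geo_comb (\<alpha> * t) p x) (geo_comb (\<beta> * t) p y) / t"
  have nn: "0 \<le> a" "0 \<le> b" using assms by (auto simp: a_def b_def)
  have ptd: "pre_tangent_dist p (\<alpha>, geodesic p x) (\<beta>, geodesic p y)
      = sqrt (a\<^sup>2 + b\<^sup>2 - 2 * a * b * cos ?\<theta>)"
    by (simp add: pre_tangent_dist_def a_def b_def Let_def)
  have small: "\<forall>\<^sub>F t in at_right 0. 0 < t \<and> \<gamma> * t \<le> 1" if "0 \<le> \<gamma>" for \<gamma> :: real
    by (rule eventually_at_rightI[of 0 "1 / (\<gamma> + 1)"]) (use that in \<open>auto simp: field_simps\<close>)
  have comb: "geo_comb (\<gamma> * t) p z = geodesic p z (\<gamma> * dist p z * t)" for \<gamma> t z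
    by (simp add: geo_comb_def mult_ac)
  have ev: "\<forall>\<^sub>F t in at_right 0. 0 < t \<and> a * t \<le> dist p x \<and> b * t \<le> dist p y"
    using small[OF assms(1)] small[OF assms(2)]
  proof eventually_elim
    case (elim t)
    then show ?case using mult_right_mono[of "\<alpha> * t" 1 "dist p x"]
        mult_right_mono[of "\<beta> * t" 1 "dist p y"] by (auto simp: a_def b_def mult_ac)
  qed
  consider "a = 0" | "b = 0" | "0 < a" "0 < b" using nn by fastforce
  then show ?thesis
  proof cases
    case 1
    have "\<forall>\<^sub>F t in at_right 0. b = ?f t"
      using ev
    proof eventually_elim
      case (elim t)
      then show ?case using 1 nn dist_geodesic_start[of "b * t" p y]
        by (simp add: comb a_def[symmetric] b_def[symmetric])
    qed
    then have "(?f \<longlongrightarrow> b) (at_right 0)"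
      by (rule Lim_transform_eventually[OF tendsto_const])
    then show ?thesis using 1 nn by (simp add: ptd)
  next
    case 2
    have "\<forall>\<^sub>F t in at_right 0. a = ?f t"
      using ev
    proof eventually_elim
      case (elim t)
      then show ?case using 2 nn dist_geodesic_start[of "a * t" p x]
        by (simp add: comb a_def[symmetric] b_def[symmetric] dist_commute)
    qed
    then have "(?f \<longlongrightarrow> a) (at_right 0)"
      by (rule Lim_transform_eventually[OF tendsto_const])
    then show ?thesis using 2 nn by (simp add: ptd)
  next
    case 3
    then have ne: "x \<noteq> p" "y \<noteq> p" by (auto simp: a_def b_def)
    have "filterlim (\<lambda>t. (a * t, b * t)) (at_right 0 \<times>\<^sub>F at_right 0) (at_right (0::real))"
      using 3 by (intro filterlim_Pair filterlim_times_pos[OF filterlim_ident]) auto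
    from filterlim_compose[OF comparison_cos_tendsto(1)[OF ne] this]
    have lim: "((\<lambda>t. comparison_cos p x y (a * t) (b * t)) \<longlongrightarrow> cos ?\<theta>) (at_right 0)"
      by simp
    have "((\<lambda>t. sqrt (a\<^sup>2 + b\<^sup>2 - 2 * a * b * comparison_cos p x y (a * t) (b * t)))
        \<longlongrightarrow> sqrt (a\<^sup>2 + b\<^sup>2 - 2 * a * b * cos ?\<theta>)) (at_right 0)"
      by (intro tendsto_intros lim)
    moreover have "\<forall>\<^sub>F t in at_right 0.
        sqrt (a\<^sup>2 + b\<^sup>2 - 2 * a * b * comparison_cos p x y (a * t) (b * t)) = ?f t"
      using ev
    proof eventually_elim
      case (elim t)
      then have "(?f t)\<^sup>2 = a\<^sup>2 + b\<^sup>2 - 2 * a * b * comparison_cos p x y (a * t) (b * t)"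
        using 3 dist_geodesic_cos[of "a * t" "b * t" p x y]
        by (simp add: comb a_def[symmetric] b_def[symmetric] power_divide field_simps power2_eq_square)
      then show ?case using elim by (metis real_sqrt_unique divide_nonneg_pos zero_le_dist)
    qed
    ultimately show ?thesis unfolding ptd by (rule Lim_transform_eventually)
  qed
qed

lemma pre_tangentE:
  assumes "a \<in> pre_tangent p"
  obtains \<alpha> x where "a = (\<alpha>, geodesic p x)" "0 \<le> \<alpha>"
  using assms by (auto simp: pre_tangent_def geodesics_from_def)

lemma geodesic_in_pre_tangent [simp]: "0 \<le> \<alpha> \<Longrightarrow> (\<alpha>, geodesic p x) \<in> pre_tangent p"
  by (simp add: pre_tangent_def geodesics_from_def)

lemma pre_tangent_dist_refl:
  fixes p :: "'a::cat0_space"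
  assumes "a \<in> pre_tangent p"
  shows "pre_tangent_dist p a a = 0"
proof -
  obtain \<alpha> x where a: "a = (\<alpha>, geodesic p x)" "0 \<le> \<alpha>"
    using assms by (rule pre_tangentE)
  from pre_tangent_dist_tendsto[of \<alpha> \<alpha> p x x] a show ?thesis
    by (simp add: tendsto_const_iff)
qed

lemma pre_tangent_dist_commute:
  fixes p :: "'a::cat0_space"
  assumes "a \<in> pre_tangent p" "b \<in> pre_tangent p"
  shows "pre_tangent_dist p a b = pre_tangent_dist p b a"
proof -
  obtain \<alpha> x where a: "a = (\<alpha>, geodesic p x)" "0 \<le> \<alpha>"
    using assms(1) by (rule pre_tangentE)
  obtain \<beta> y where b: "b = (\<beta>, geodesic p y)" "0 \<le> \<beta>"
    using assms(2) by (rule pre_tangentE)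
  show ?thesis
    using tendsto_unique[OF _ pre_tangent_dist_tendsto[of \<alpha> \<beta> p x y]]
      pre_tangent_dist_tendsto[of \<beta> \<alpha> p y x] a b by (simp add: dist_commute)
qed

lemma pre_tangent_dist_triangle:
  fixes p :: "'a::cat0_space"
  assumes "a \<in> pre_tangent p" "b \<in> pre_tangent p" "c \<in> pre_tangent p"
  shows "pre_tangent_dist p a c \<le> pre_tangent_dist p a b + pre_tangent_dist p b c"
proof -
  obtain \<alpha> x where a: "a = (\<alpha>, geodesic p x)" "0 \<le> \<alpha>"
    using assms(1) by (rule pre_tangentE)
  obtain \<beta> y where b: "b = (\<beta>, geodesic p y)" "0 \<le> \<beta>"
    using assms(2) by (rule pre_tangentE)
  obtain \<gamma> z where c: "c = (\<gamma>, geodesic p z)" "0 \<le> \<gamma>"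
    using assms(3) by (rule pre_tangentE)
  let ?P = "\<lambda>t. geo_comb (\<alpha> * t) p x" and ?Q = "\<lambda>t. geo_comb (\<beta> * t) p y"
    and ?R = "\<lambda>t. geo_comb (\<gamma> * t) p z"
  have "\<forall>\<^sub>F t in at_right (0::real).
      dist (?P t) (?R t) / t \<le> dist (?P t) (?Q t) / t + dist (?Q t) (?R t) / t"
    using eventually_at_right_less[of "0::real"]
    by eventually_elim
       (simp add: add_divide_distrib[symmetric] divide_right_mono dist_triangle)
  then show ?thesis unfolding a b c
    using a b c by (intro tendsto_le[OF _ tendsto_add]) (auto intro: pre_tangent_dist_tendsto)
qed

lemma tangent_dist_tangent_class:
  fixes p :: "'a::cat0_space"
  assumes "a \<in> pre_tangent p" "b \<in> pre_tangent p"
  shows "tangent_dist p (tangent_rel p `` {a}) (tangent_rel p `` {b}) = pre_tangent_dist p a b"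
proof -
  have eq: "pre_tangent_dist p a' b' = pre_tangent_dist p a b"
    if "(a, a') \<in> tangent_rel p" "(b, b') \<in> tangent_rel p" for a' b'
  proof -
    have m: "a' \<in> pre_tangent p" "b' \<in> pre_tangent p"
      and z: "pre_tangent_dist p a a' = 0" "pre_tangent_dist p b b' = 0"
      using that by (auto simp: tangent_rel_def)
    have z': "pre_tangent_dist p a' a = 0" "pre_tangent_dist p b' b = 0"
      using pre_tangent_dist_commute assms m z by metis+
    show ?thesis
      using pre_tangent_dist_triangle[of a' p a b'] pre_tangent_dist_triangle[of a p b b']
        pre_tangent_dist_triangle[of a p a' b] pre_tangent_dist_triangle[of a' p b' b]
        assms m z z' by linarith
  qed
  have refl: "(a, a) \<in> tangent_rel p" "(b, b) \<in> tangent_rel p"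
    using assms by (simp_all add: tangent_rel_def pre_tangent_dist_refl)
  show ?thesis unfolding tangent_dist_def
  proof (rule the_equality)
    show "\<forall>a'\<in>tangent_rel p `` {a}. \<forall>b'\<in>tangent_rel p `` {b}.
        pre_tangent_dist p a' b' = pre_tangent_dist p a b"
      by (blast intro: eq)
  next
    fix r assume "\<forall>a'\<in>tangent_rel p `` {a}. \<forall>b'\<in>tangent_rel p `` {b}. pre_tangent_dist p a' b' = r"
    then have "pre_tangent_dist p a b = r" using refl by blast
    then show "r = pre_tangent_dist p a b" by simp
  qed
qed

lemma tangent_inner_tangent_class:
  fixes p x y :: "'a::cat0_space"
  assumes "0 \<le> \<alpha>" "0 \<le> \<beta>"
  shows "tangent_inner p (tangent_class p \<alpha> (geodesic p x)) (tangent_class p \<beta> (geodesic p y)) =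
    \<alpha> * dist p x * \<beta> * dist p y * cos (alexandrov_angle p (geodesic p x) (geodesic p y))"
proof -
  define a b c where "a = \<alpha> * dist p x" and "b = \<beta> * dist p y"
    and "c = cos (alexandrov_angle p (geodesic p x) (geodesic p y))"
  have nn: "0 \<le> a" "0 \<le> b" using assms by (auto simp: a_def b_def)
  have "a * b * c \<le> a * b * 1"
    using nn by (intro mult_left_mono) (auto simp: c_def)
  then have "2 * a * b * c \<le> a\<^sup>2 + b\<^sup>2"
    using zero_le_power2[of "a - b"] by (simp add: power2_diff)
  then have "(pre_tangent_dist p (\<alpha>, geodesic p x) (\<beta>, geodesic p y))\<^sup>2 = a\<^sup>2 + b\<^sup>2 - 2 * a * b * c"
    by (simp add: pre_tangent_dist_def Let_def a_def b_def c_def)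
  moreover have "pre_tangent_dist p (\<alpha>, geodesic p x) (0, geodesic p p) = a"
    "pre_tangent_dist p (\<beta>, geodesic p y) (0, geodesic p p) = b"
    using nn by (simp_all add: pre_tangent_dist_def Let_def a_def b_def)
  ultimately show ?thesis
    using assms by (simp add: tangent_inner_def tangent_zero_def tangent_class_def
        tangent_dist_tangent_class a_def[symmetric] b_def[symmetric] c_def[symmetric])
qed

text \<open>Alexandrov angles do not exceed comparison angles.\<close>

lemma tangent_inner_ge:
  fixes p x y :: "'a::cat0_space"
  assumes "0 \<le> \<alpha>"
  shows "\<alpha> * ((dist p x)\<^sup>2 + (dist p y)\<^sup>2 - (dist x y)\<^sup>2) / 2 \<le>
    tangent_inner p (tangent_class p \<alpha> (geodesic p x)) (tangent_class p 1 (geodesic p y))"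
proof (cases "x = p \<or> y = p")
  case True
  then show ?thesis using assms by (auto simp: tangent_inner_tangent_class dist_commute)
next
  case False
  then have pos: "0 < dist p x" "0 < dist p y" by auto
  have "\<alpha> * (dist p x * dist p y * comparison_cos p x y (dist p x) (dist p y)) \<le>
      \<alpha> * (dist p x * dist p y * cos (alexandrov_angle p (geodesic p x) (geodesic p y)))"
    using False assms by (intro mult_left_mono comparison_cos_tendsto) auto
  moreover have "dist p x * dist p y * comparison_cos p x y (dist p x) (dist p y)
      = ((dist p x)\<^sup>2 + (dist p y)\<^sup>2 - (dist x y)\<^sup>2) / 2"
    using pos by (simp add: comparison_cos_def)
  ultimately have "\<alpha> * (((dist p x)\<^sup>2 + (dist p y)\<^sup>2 - (dist x y)\<^sup>2) / 2) \<le>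
      \<alpha> * (dist p x * dist p y * cos (alexandrov_angle p (geodesic p x) (geodesic p y)))"
    by simp
  then show ?thesis using assms by (simp add: tangent_inner_tangent_class mult_ac)
qed

lemma tangent_class_constant:
  fixes p :: "'a::cat0_space"
  assumes "0 \<le> \<alpha>"
  shows "tangent_class p \<alpha> (geodesic p p) = tangent_zero p"
  using assms by (auto simp: tangent_zero_def tangent_class_def tangent_rel_def pre_tangent_dist_def Let_def)

section \<open>Resolvents\<close>

lemma monotone_vector_field_dist:
  fixes A :: "'a::cat0_space \<Rightarrow> 'a tangent set"
  assumes "monotone_vector_field A" "0 \<le> r" "0 \<le> s"
    and "tangent_class z r (geodesic z x) \<in> A z" "tangent_class w s (geodesic w y) \<in> A w"
  shows "r * ((dist z x)\<^sup>2 + (dist z w)\<^sup>2 - (dist x w)\<^sup>2) +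
    s * ((dist w y)\<^sup>2 + (dist w z)\<^sup>2 - (dist y z)\<^sup>2) \<le> 0"
proof -
  have "tangent_inner z (tangent_class z r (geodesic z x)) (tangent_class z 1 (geodesic z w)) +
    tangent_inner w (tangent_class w s (geodesic w y)) (tangent_class w 1 (geodesic w z)) \<le> 0"
    using assms unfolding monotone_vector_field_def by blast
  then show ?thesis
    using tangent_inner_ge[OF assms(2), of z x w] tangent_inner_ge[OF assms(3), of w y z] by linarith
qed

text \<open>The resolvent set is a singleton, so that the resolvent satisfies its defining inclusion.\<close>

lemma resolvent_mem:
  fixes A :: "'a::cat0_space \<Rightarrow> 'a tangent set"
  assumes "monotone_vector_field A" "surjectivity_condition A" "0 < \<mu>"
  shows "tangent_class (resolvent A \<mu> x) (1 / \<mu>) (geodesic (resolvent A \<mu> x) x) \<in> A (resolvent A \<mu> x)"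
proof -
  obtain z where z: "z \<in> resolvent_set A \<mu> x"
    using assms(2,3) unfolding surjectivity_condition_def resolvent_set_def by blast
  have "w = z" if w: "w \<in> resolvent_set A \<mu> x" for w
  proof -
    have "1 / \<mu> * ((dist z x)\<^sup>2 + (dist z w)\<^sup>2 - (dist x w)\<^sup>2) +
        1 / \<mu> * ((dist w x)\<^sup>2 + (dist w z)\<^sup>2 - (dist x z)\<^sup>2) \<le> 0"
      using assms z w by (intro monotone_vector_field_dist) (auto simp: resolvent_set_def)
    then have "1 / \<mu> * (2 * (dist w z)\<^sup>2) \<le> 0"
      by (simp add: algebra_simps dist_commute)
    then show ?thesis using assms(3) by (simp add: divide_le_0_iff)
  qed
  with z have "resolvent_set A \<mu> x = {z}" by blast
  with z show ?thesis by (simp add: resolvent_def resolvent_set_def)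
qed

lemma resolvent_dist:
  fixes A :: "'a::cat0_space \<Rightarrow> 'a tangent set"
    and x y :: 'a
    and \<mu> \<nu> :: real
  assumes "monotone_vector_field A" "surjectivity_condition A" "0 < \<mu>" "0 < \<nu>"
  defines "z \<equiv> resolvent A \<mu> x" and "w \<equiv> resolvent A \<nu> y"
  shows "1 / \<mu> * ((dist z x)\<^sup>2 + (dist z w)\<^sup>2 - (dist x w)\<^sup>2) +
    1 / \<nu> * ((dist w y)\<^sup>2 + (dist w z)\<^sup>2 - (dist y z)\<^sup>2) \<le> 0"
  unfolding z_def w_def using assms(3,4)
  by (intro monotone_vector_field_dist[OF assms(1)] resolvent_mem[OF assms(1,2)]) auto

lemma resolvent_dist_zero:
  fixes A :: "'a::cat0_space \<Rightarrow> 'a tangent set"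
  assumes "monotone_vector_field A" "surjectivity_condition A" "0 < \<mu>" "u \<in> zeros A"
  shows "(dist (resolvent A \<mu> x) x)\<^sup>2 + (dist (resolvent A \<mu> x) u)\<^sup>2 \<le> (dist x u)\<^sup>2"
proof -
  let ?z = "resolvent A \<mu> x"
  have "1 / \<mu> * ((dist ?z x)\<^sup>2 + (dist ?z u)\<^sup>2 - (dist x u)\<^sup>2) +
      0 * ((dist u u)\<^sup>2 + (dist u ?z)\<^sup>2 - (dist u ?z)\<^sup>2) \<le> 0"
    using assms(3,4) resolvent_mem[OF assms(1-3), of x]
    by (intro monotone_vector_field_dist[OF assms(1)]) (auto simp: zeros_def tangent_zero_def)
  then show ?thesis using assms(3) by (simp add: divide_le_0_iff)
qed

lemma resolvent_fixed_imp_zero: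
  fixes A :: "'a::cat0_space \<Rightarrow> 'a tangent set"
  assumes "monotone_vector_field A" "surjectivity_condition A" "0 < \<mu>" "resolvent A \<mu> q = q"
  shows "q \<in> zeros A"
  using resolvent_mem[OF assms(1-3), of q] assms(3,4) by (simp add: tangent_class_constant zeros_def)

lemma resolvent_dist_mono:
  fixes A :: "'a::cat0_space \<Rightarrow> 'a tangent set"
  assumes "monotone_vector_field A" "surjectivity_condition A" "0 < \<mu>" "\<mu> \<le> \<nu>"
  shows "(dist (resolvent A \<mu> v) v)\<^sup>2 + (dist (resolvent A \<mu> v) (resolvent A \<nu> v))\<^sup>2
    \<le> (dist (resolvent A \<nu> v) v)\<^sup>2"
proof (cases "\<mu> = \<nu>")
  case False
  let ?z = "resolvent A \<mu> v" and ?w = "resolvent A \<nu> v"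
  have less: "1 / \<nu> < 1 / \<mu>" using False assms by (simp add: field_simps)
  have "1 / \<mu> * ((dist ?z v)\<^sup>2 + (dist ?z ?w)\<^sup>2 - (dist v ?w)\<^sup>2) +
    1 / \<nu> * ((dist ?w v)\<^sup>2 + (dist ?w ?z)\<^sup>2 - (dist v ?z)\<^sup>2) \<le> 0"
    using assms by (intro resolvent_dist) auto
  then have "(1 / \<mu> - 1 / \<nu>) * ((dist ?z v)\<^sup>2 + (dist ?z ?w)\<^sup>2 - (dist ?w v)\<^sup>2)
      \<le> - (2 / \<nu> * (dist ?z ?w)\<^sup>2)"
    by (simp add: algebra_simps dist_commute)
  also have "\<dots> \<le> 0" using assms by simp
  finally show ?thesis using less by (simp add: mult_le_0_iff)
qed simp

text \<open>The squared distances of the resolvents to \<open>v\<close> increase with the parameter and are bounded;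
  as their differences dominate the squared mutual distances of the resolvents, the latter converge.
  The last conclusion makes the limit the unique zero nearest to \<open>v\<close>, without any appeal to
  closedness or convexity of the set of zeros.\<close>

lemma resolvent_tendsto_nearest_zero:
  fixes A :: "'a::hadamard_space \<Rightarrow> 'a tangent set"
  assumes A: "monotone_vector_field A" "surjectivity_condition A" and "zeros A \<noteq> {}"
  obtains q where "q \<in> zeros A" "(\<lambda>k. resolvent A (real (Suc k)) v) \<longlonglongrightarrow> q"
    "\<And>u. u \<in> zeros A \<Longrightarrow> (dist q v)\<^sup>2 + (dist q u)\<^sup>2 \<le> (dist v u)\<^sup>2"
proof -
  define w where "w k = resolvent A (real (Suc k)) v" for k
  have w_zero: "(dist (w k) v)\<^sup>2 + (dist (w k) u)\<^sup>2 \<le> (dist v u)\<^sup>2" if "u \<in> zeros A" for k u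
    unfolding w_def using A that by (intro resolvent_dist_zero) auto
  have mono: "(dist (w i) v)\<^sup>2 + (dist (w i) (w j))\<^sup>2 \<le> (dist (w j) v)\<^sup>2" if "i \<le> j" for i j
    unfolding w_def using A that by (intro resolvent_dist_mono) auto
  obtain u where u: "u \<in> zeros A" using assms by blast
  have "incseq (\<lambda>k. (dist (w k) v)\<^sup>2)"
  proof (rule incseq_SucI)
    show "(dist (w k) v)\<^sup>2 \<le> (dist (w (Suc k)) v)\<^sup>2" for k
      using mono[of k "Suc k"] zero_le_power2[of "dist (w k) (w (Suc k))"] by linarith
  qed
  moreover have "(dist (w k) v)\<^sup>2 \<le> (dist v u)\<^sup>2" for k
    using w_zero[OF u, of k] zero_le_power2[of "dist (w k) u"] by linarith
  then have "\<forall>k. (dist (w k) v)\<^sup>2 \<le> (dist v u)\<^sup>2" ..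
  ultimately obtain L where "(\<lambda>k. (dist (w k) v)\<^sup>2) \<longlonglongrightarrow> L"
    by (rule incseq_convergent)
  then have Cau: "Cauchy (\<lambda>k. (dist (w k) v)\<^sup>2)" by (rule LIMSEQ_imp_Cauchy)
  have "Cauchy w"
  proof (rule metric_CauchyI)
    fix e :: real assume e: "0 < e"
    then obtain N where N: "\<And>i j. N \<le> i \<Longrightarrow> N \<le> j \<Longrightarrow> dist ((dist (w i) v)\<^sup>2) ((dist (w j) v)\<^sup>2) < e\<^sup>2"
      using metric_CauchyD[OF Cau, of "e\<^sup>2"] by auto
    have lt: "dist (w i) (w j) < e" if "N \<le> i" "i \<le> j" for i j
    proof -
      have "(dist (w i) (w j))\<^sup>2 < e\<^sup>2"
        using mono[OF that(2)] N[of i j] that unfolding dist_real_def by linarith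
      then show ?thesis using e by (simp add: power2_less_imp_less)
    qed
    show "\<exists>M. \<forall>m\<ge>M. \<forall>n\<ge>M. dist (w m) (w n) < e"
    proof (intro exI allI impI)
      fix i j assume "N \<le> i" "N \<le> j"
      then show "dist (w i) (w j) < e"
        using lt[of i j] lt[of j i] by (cases "i \<le> j") (auto simp: dist_commute)
    qed
  qed
  then obtain q where q: "w \<longlonglongrightarrow> q"
    unfolding Cauchy_convergent_iff convergent_def by blast
  have "(dist q v)\<^sup>2 + (dist q u)\<^sup>2 \<le> (dist v u)\<^sup>2" if "u \<in> zeros A" for u
  proof (rule LIMSEQ_le_const2)
    show "(\<lambda>k. (dist (w k) v)\<^sup>2 + (dist (w k) u)\<^sup>2) \<longlonglongrightarrow> (dist q v)\<^sup>2 + (dist q u)\<^sup>2"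
      by (intro tendsto_add tendsto_power tendsto_dist q tendsto_const)
  qed (use w_zero[OF that] in blast)
  moreover have "q \<in> zeros A"
  proof -
    \<comment> \<open>Comparing the resolvents \<open>z\<close> of \<open>q\<close> and \<open>w k\<close> of \<open>v\<close>, the term of \<open>w k\<close> has weight
      \<open>1 / (k + 1)\<close> and vanishes in the limit.\<close>
    define z where "z = resolvent A 1 q"
    have ineq: "((dist z q)\<^sup>2 + (dist z (w k))\<^sup>2 - (dist q (w k))\<^sup>2) +
        inverse (real (Suc k)) * ((dist (w k) v)\<^sup>2 + (dist (w k) z)\<^sup>2 - (dist v z)\<^sup>2) \<le> 0" for k
      using resolvent_dist[OF A, of 1 "real (Suc k)" q v]
      by (simp add: z_def w_def inverse_eq_divide)
    have "(\<lambda>k. ((dist z q)\<^sup>2 + (dist z (w k))\<^sup>2 - (dist q (w k))\<^sup>2) +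
        inverse (real (Suc k)) * ((dist (w k) v)\<^sup>2 + (dist (w k) z)\<^sup>2 - (dist v z)\<^sup>2))
      \<longlonglongrightarrow> ((dist z q)\<^sup>2 + (dist z q)\<^sup>2 - (dist q q)\<^sup>2) +
        0 * ((dist q v)\<^sup>2 + (dist q z)\<^sup>2 - (dist v z)\<^sup>2)"
      by (intro tendsto_add tendsto_diff tendsto_mult tendsto_power tendsto_dist q tendsto_const
          LIMSEQ_inverse_real_of_nat)
    then have "((dist z q)\<^sup>2 + (dist z q)\<^sup>2 - (dist q q)\<^sup>2) +
        0 * ((dist q v)\<^sup>2 + (dist q z)\<^sup>2 - (dist v z)\<^sup>2) \<le> 0"
      by (rule LIMSEQ_le_const2) (use ineq in blast)
    then have "z = q" by simp
    then show ?thesis using A by (intro resolvent_fixed_imp_zero[of A 1]) (auto simp: z_def)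
  qed
  ultimately show ?thesis using that q unfolding w_def by blast
qed

section \<open>Convergence of the Halpern iteration\<close>

text \<open>Since \<open>1 - \<alpha> n \<le> exp (- \<alpha> n)\<close>, the excess of \<open>s n\<close> over \<open>e\<close> decays at least like the
  exponential of minus the partial sums of \<open>\<alpha>\<close>.\<close>

lemma recursive_inequality_tendsto_0:
  fixes s \<alpha> :: "nat \<Rightarrow> real"
  assumes nonneg: "\<And>n. 0 \<le> s n"
    and \<alpha>: "\<And>n. n \<ge> 1 \<Longrightarrow> \<alpha> n \<le> 1"
    and div: "filterlim (\<lambda>N. \<Sum>n=1..N. \<alpha> n) at_top sequentially"
    and step: "\<And>e. 0 < e \<Longrightarrow> \<forall>\<^sub>F n in sequentially. s (Suc n) \<le> (1 - \<alpha> n) * s n + \<alpha> n * e"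
  shows "s \<longlonglongrightarrow> 0"
proof (rule LIMSEQ_I)
  fix r :: real assume "0 < r"
  define e where "e = r / 2"
  have e: "0 < e" using \<open>0 < r\<close> by (simp add: e_def)
  define S where "S n = (\<Sum>i=1..<n. \<alpha> i)" for n
  have S_Suc: "S (Suc n) = S n + \<alpha> n" if "1 \<le> n" for n
    using that by (simp add: S_def)
  have "filterlim (\<lambda>n. S (Suc n)) at_top sequentially"
    using div by (simp add: S_def atLeastLessThanSuc_atLeastAtMost)
  then have S: "filterlim S at_top sequentially"
    by (simp add: filterlim_sequentially_Suc)
  obtain N0 where N0: "\<And>n. N0 \<le> n \<Longrightarrow> s (Suc n) \<le> (1 - \<alpha> n) * s n + \<alpha> n * e"
    using step[OF e] by (auto simp: eventually_sequentially)
  define N where "N = max 1 N0"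
  define C where "C = \<bar>s N - e\<bar>"
  have bound: "s n - e \<le> exp (S N - S n) * C" if "N \<le> n" for n
    using that
  proof (induction n rule: dec_induct)
    case base
    then show ?case by (simp add: C_def)
  next
    case (step n)
    have n: "1 \<le> n" "N0 \<le> n" using step.hyps by (auto simp: N_def)
    have "s (Suc n) - e \<le> (1 - \<alpha> n) * (s n - e)"
      using N0[OF n(2)] by (simp add: algebra_simps)
    also have "\<dots> \<le> (1 - \<alpha> n) * (exp (S N - S n) * C)"
      using step.IH \<alpha>[OF n(1)] by (intro mult_left_mono) auto
    also have "\<dots> \<le> exp (- \<alpha> n) * (exp (S N - S n) * C)"
      using exp_ge_add_one_self[of "- \<alpha> n"] by (intro mult_right_mono) (auto simp: C_def)
    also have "\<dots> = exp (S N - S (Suc n)) * C"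
      by (simp add: S_Suc[OF n(1)] mult_exp_exp[symmetric] exp_diff exp_minus exp_add field_simps)
    finally show ?case .
  qed
  have "filterlim (\<lambda>n. S N + - S n) at_bot sequentially"
    using S unfolding filterlim_tendsto_add_at_bot_iff[OF tendsto_const] filterlim_uminus_at_top .
  then have "(\<lambda>n. exp (S N - S n)) \<longlonglongrightarrow> 0"
    using filterlim_compose[OF exp_at_bot] by simp
  then have "(\<lambda>n. exp (S N - S n) * C) \<longlonglongrightarrow> 0" by (rule tendsto_mult_left_zero)
  then have "\<forall>\<^sub>F n in sequentially. exp (S N - S n) * C < e"
    using e by (rule order_tendstoD(2))
  then have "\<forall>\<^sub>F n in sequentially. norm (s n - 0) < r"
    using eventually_ge_at_top[of N]
  proof eventually_elim
    case (elim n)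
    then show ?case using bound[of n] nonneg[of n] by (simp add: e_def)
  qed
  then show "\<exists>no. \<forall>n\<ge>no. norm (s n - 0) < r" by (simp add: eventually_sequentially)
qed

lemma metric_projection_eqI:
  assumes "q \<in> C" "\<And>u. u \<in> C \<Longrightarrow> (dist q v)\<^sup>2 + (dist q u)\<^sup>2 \<le> (dist v u)\<^sup>2"
  shows "metric_projection C v = q"
  unfolding metric_projection_def
proof (rule the_equality)
  have "dist q v \<le> dist u v" if "u \<in> C" for u
  proof (rule power2_le_imp_le)
    show "(dist q v)\<^sup>2 \<le> (dist u v)\<^sup>2"
      unfolding dist_commute[of u v] using assms(2)[OF that] zero_le_power2[of "dist q u"] by linarith
  qed simp
  then show "q \<in> C \<and> (\<forall>z\<in>C. dist q v \<le> dist z v)" using assms(1) by blast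
next
  fix y assume y: "y \<in> C \<and> (\<forall>z\<in>C. dist y v \<le> dist z v)"
  then have "(dist y v)\<^sup>2 \<le> (dist q v)\<^sup>2" using assms(1) by (intro power_mono) auto
  moreover have "(dist q v)\<^sup>2 + (dist q y)\<^sup>2 \<le> (dist y v)\<^sup>2"
    using assms(2)[of y] y by (simp add: dist_commute)
  ultimately have "(dist q y)\<^sup>2 \<le> 0" by linarith
  then show "y = q" by simp
qed

text \<open>One step of the iteration from \<open>y\<close>, compared with the resolvent \<open>w\<close> of the anchor \<open>v\<close>. The
  comparison costs a term of order \<open>\<alpha> * dist z y\<close>, which the term \<open>(dist z y)\<^sup>2\<close> gained in the
  resolvent step absorbs up to an error of order \<open>\<alpha>\<^sup>2\<close>.\<close>

lemma halpern_step:
  fixes A :: "'a::cat0_space \<Rightarrow> 'a tangent set"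
    and p v y :: 'a
    and l \<mu> \<nu> \<alpha> R :: real
  assumes A: "monotone_vector_field A" "surjectivity_condition A"
    and p: "p \<in> zeros A" and \<mu>: "0 < l" "l \<le> \<mu>" and \<nu>: "0 < \<nu>" and \<alpha>: "0 \<le> \<alpha>" "\<alpha> \<le> 1"
  defines "z \<equiv> resolvent A \<mu> y" and "w \<equiv> resolvent A \<nu> v"
  assumes R: "dist y p \<le> R"
  shows "(dist (geo_comb (1 - \<alpha>) v z) p)\<^sup>2 \<le> (1 - \<alpha>) * (dist y p)\<^sup>2 +
    \<alpha> * ((dist v p)\<^sup>2 - (dist w v)\<^sup>2 + \<alpha> * ((dist w v)\<^sup>2 + (\<nu> / l * (2 * (R + dist p w)))\<^sup>2))"
proof -
  define K where "K = \<nu> / l * (2 * (R + dist p w))"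
  define d where "d = dist z y"
  have zero: "d\<^sup>2 + (dist z p)\<^sup>2 \<le> (dist y p)\<^sup>2"
    unfolding z_def d_def using A p \<mu> by (intro resolvent_dist_zero) auto
  then have "(dist z p)\<^sup>2 \<le> (dist y p)\<^sup>2" using zero_le_power2[of d] by linarith
  then have zp: "dist z p \<le> dist y p" by (rule power2_le_imp_le) simp
  have M: "dist y w + dist z w \<le> 2 * (R + dist p w)"
    using dist_triangle[of y w p] dist_triangle[of z w p] zp R by simp
  have R0: "0 \<le> R + dist p w" using R zero_le_dist[of y p] zero_le_dist[of p w] by linarith
  have "(dist y w)\<^sup>2 - (dist z w)\<^sup>2 = (dist y w - dist z w) * (dist y w + dist z w)"
    by (simp add: power2_eq_square algebra_simps)
  also have "\<dots> \<le> d * (dist y w + dist z w)"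
    using dist_triangle[of y w z] by (intro mult_right_mono) (auto simp: d_def dist_commute)
  also have "\<dots> \<le> d * (2 * (R + dist p w))"
    using M by (intro mult_left_mono) (auto simp: d_def)
  finally have yz: "(dist y w)\<^sup>2 - (dist z w)\<^sup>2 \<le> d * (2 * (R + dist p w))" .
  have "1 / \<mu> * ((dist z y)\<^sup>2 + (dist z w)\<^sup>2 - (dist y w)\<^sup>2) +
      1 / \<nu> * ((dist w v)\<^sup>2 + (dist w z)\<^sup>2 - (dist v z)\<^sup>2) \<le> 0"
    unfolding z_def w_def using A \<mu> \<nu> by (intro resolvent_dist) auto
  moreover have "1 / \<mu> * (- (d * (2 * (R + dist p w)))) \<le> 1 / \<mu> * ((dist z y)\<^sup>2 + (dist z w)\<^sup>2 - (dist y w)\<^sup>2)"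
  proof (rule mult_left_mono)
    show "- (d * (2 * (R + dist p w))) \<le> (dist z y)\<^sup>2 + (dist z w)\<^sup>2 - (dist y w)\<^sup>2"
      using yz zero_le_power2[of "dist z y"] by linarith
  qed (use \<mu> in simp)
  moreover have "1 / \<mu> * (d * (2 * (R + dist p w))) \<le> 1 / l * (d * (2 * (R + dist p w)))"
    using \<mu> R0 by (intro mult_right_mono divide_left_mono mult_nonneg_nonneg) (auto simp: d_def)
  moreover have "1 / \<nu> * ((dist w v)\<^sup>2 - (dist v z)\<^sup>2) \<le> 1 / \<nu> * ((dist w v)\<^sup>2 + (dist w z)\<^sup>2 - (dist v z)\<^sup>2)"
    using \<nu> by (intro mult_left_mono) auto
  ultimately have "1 / \<nu> * ((dist w v)\<^sup>2 - (dist v z)\<^sup>2) \<le> 1 / l * (d * (2 * (R + dist p w)))"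
    by linarith
  then have "\<nu> * (1 / \<nu> * ((dist w v)\<^sup>2 - (dist v z)\<^sup>2)) \<le> \<nu> * (1 / l * (d * (2 * (R + dist p w))))"
    using \<nu> by (intro mult_left_mono) auto
  then have wv: "(dist w v)\<^sup>2 - K * d \<le> (dist v z)\<^sup>2"
    using \<nu> by (simp add: K_def mult_ac)
  have "(\<alpha> * K - 2 * d)\<^sup>2 = (\<alpha> * K)\<^sup>2 - 4 * (\<alpha> * K * d) + 4 * d\<^sup>2"
    by (simp add: power2_diff)
  then have sq: "\<alpha> * K * d - d\<^sup>2 \<le> (\<alpha> * K)\<^sup>2"
    using zero_le_power2[of "\<alpha> * K - 2 * d"] zero_le_power2[of "\<alpha> * K"] by linarith
  have "(dist (geo_comb (1 - \<alpha>) v z) p)\<^sup>2 \<le>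
      \<alpha> * (dist v p)\<^sup>2 + (1 - \<alpha>) * (dist z p)\<^sup>2 - (1 - \<alpha>) * \<alpha> * (dist v z)\<^sup>2"
    using cat0_convex_dist_square[of "1 - \<alpha>" v z p] \<alpha> by simp
  also have "\<dots> \<le> \<alpha> * (dist v p)\<^sup>2 + (1 - \<alpha>) * ((dist y p)\<^sup>2 - d\<^sup>2)
      - (1 - \<alpha>) * \<alpha> * ((dist w v)\<^sup>2 - K * d)"
    using zero wv \<alpha> by (intro diff_mono add_mono mult_left_mono) auto
  also have "\<dots> = \<alpha> * (dist v p)\<^sup>2 + (1 - \<alpha>) * (dist y p)\<^sup>2 - (1 - \<alpha>) * \<alpha> * (dist w v)\<^sup>2
      + (1 - \<alpha>) * (\<alpha> * K * d - d\<^sup>2)"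
    by (simp add: algebra_simps)
  also have "(1 - \<alpha>) * (\<alpha> * K * d - d\<^sup>2) \<le> (1 - \<alpha>) * (\<alpha> * K)\<^sup>2"
    using sq \<alpha> by (intro mult_left_mono) auto
  also have "\<dots> \<le> 1 * (\<alpha> * K)\<^sup>2"
    using \<alpha> by (intro mult_right_mono) auto
  finally show ?thesis
    unfolding K_def[symmetric] by (simp add: power2_eq_square algebra_simps)
qed

theorem theorem6p5:
  fixes A :: "'a::hadamard_space \<Rightarrow> 'a tangent set"
    and v :: 'a
    and x :: "nat \<Rightarrow> 'a"
    and \<alpha> \<mu> :: "nat \<Rightarrow> real"
  assumes "monotone_vector_field A"
    and "surjectivity_condition A"
    and "\<And>n. n \<ge> 1 \<Longrightarrow> \<alpha> n \<in> {0<..1}"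
    and "\<And>n. n \<ge> 1 \<Longrightarrow> \<mu> n > 0"
    and "\<And>n. n \<ge> 1 \<Longrightarrow> x (Suc n) = geo_comb (1 - \<alpha> n) v (resolvent A (\<mu> n) (x n))"
    and "\<alpha> \<longlonglongrightarrow> 0"
    and "filterlim (\<lambda>N. \<Sum>n=1..N. \<alpha> n) at_top sequentially"
    and "(INF n\<in>{1..}. \<mu> n) > 0"
    and "zeros A \<noteq> {}"
  shows "x \<longlonglongrightarrow> metric_projection (zeros A) v \<and>
         (\<lambda>n. resolvent A (\<mu> n) (x n)) \<longlonglongrightarrow> metric_projection (zeros A) v"
proof -
  note A = assms(1,2)
  define z where "z n = resolvent A (\<mu> n) (x n)" for n
  define w where "w k = resolvent A (real (Suc k)) v" for k
  define l where "l = (INF n\<in>{1..}. \<mu> n)"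
  obtain p where p: "p \<in> zeros A" and w: "w \<longlonglongrightarrow> p"
    and near: "\<And>u. u \<in> zeros A \<Longrightarrow> (dist p v)\<^sup>2 + (dist p u)\<^sup>2 \<le> (dist v u)\<^sup>2"
    using resolvent_tendsto_nearest_zero[OF A assms(9), of v] unfolding w_def by blast
  have proj: "metric_projection (zeros A) v = p"
    using p near by (rule metric_projection_eqI)
  have "bdd_below (\<mu> ` {1..})"
    using assms(4) by (intro bdd_belowI[of _ 0]) (auto intro: less_imp_le)
  then have l: "0 < l" "\<And>n. 1 \<le> n \<Longrightarrow> l \<le> \<mu> n"
    using assms(8) by (auto simp: l_def intro: cINF_lower)
  have \<alpha>: "0 \<le> \<alpha> n" "\<alpha> n \<le> 1" if "1 \<le> n" for n
    using assms(3)[OF that] by auto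
  have zp: "dist (z n) p \<le> dist (x n) p" if "1 \<le> n" for n
  proof (rule power2_le_imp_le)
    show "(dist (z n) p)\<^sup>2 \<le> (dist (x n) p)\<^sup>2"
      using resolvent_dist_zero[OF A assms(4)[OF that] p, of "x n"]
        zero_le_power2[of "dist (z n) (x n)"] unfolding z_def by linarith
  qed simp
  define R where "R = max (dist (x 1) p) (dist v p)"
  have R: "dist (x n) p \<le> R" if "1 \<le> n" for n
    using that
  proof (induction n rule: dec_induct)
    case base
    then show ?case by (simp add: R_def)
  next
    case (step n)
    have R0: "0 \<le> R" "dist v p \<le> R" by (auto simp: R_def le_max_iff_disj)
    have \<alpha>n: "0 \<le> \<alpha> n" "\<alpha> n \<le> 1" using \<alpha> step.hyps by auto
    have "(dist (x (Suc n)) p)\<^sup>2 \<le>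
        \<alpha> n * (dist v p)\<^sup>2 + (1 - \<alpha> n) * (dist (z n) p)\<^sup>2 - (1 - \<alpha> n) * \<alpha> n * (dist v (z n))\<^sup>2"
      using cat0_convex_dist_square[of "1 - \<alpha> n" v "z n" p] assms(5)[of n] step.hyps \<alpha>n
      by (simp add: z_def)
    also have "\<dots> \<le> \<alpha> n * (dist v p)\<^sup>2 + (1 - \<alpha> n) * (dist (z n) p)\<^sup>2"
      using \<alpha>n by simp
    also have "\<dots> \<le> \<alpha> n * R\<^sup>2 + (1 - \<alpha> n) * R\<^sup>2"
      using \<alpha>n R0 zp[of n] step by (intro add_mono mult_left_mono power_mono) auto
    finally have "(dist (x (Suc n)) p)\<^sup>2 \<le> R\<^sup>2" by (simp add: algebra_simps)
    then show ?case using R0(1) by (rule power2_le_imp_le)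
  qed
  have "(\<lambda>n. (dist (x n) p)\<^sup>2) \<longlonglongrightarrow> 0"
  proof (rule recursive_inequality_tendsto_0[where \<alpha> = \<alpha>])
    fix e :: real assume e: "0 < e"
    have "(\<lambda>k. (dist v p)\<^sup>2 - (dist (w k) v)\<^sup>2) \<longlonglongrightarrow> (dist v p)\<^sup>2 - (dist p v)\<^sup>2"
      by (intro tendsto_intros w)
    then have "\<forall>\<^sub>F k in sequentially. (dist v p)\<^sup>2 - (dist (w k) v)\<^sup>2 < e / 2"
      by (rule order_tendstoD) (use e in \<open>simp add: dist_commute\<close>)
    then obtain k where k: "(dist v p)\<^sup>2 - (dist (w k) v)\<^sup>2 < e / 2"
      unfolding eventually_sequentially by blast
    \<comment> \<open>With \<open>k\<close> fixed, the remaining error is of order \<open>\<alpha> n\<close>.\<close>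
    define M where "M = (dist (w k) v)\<^sup>2 + (real (Suc k) / l * (2 * (R + dist p (w k))))\<^sup>2"
    have "(\<lambda>n. \<alpha> n * M) \<longlonglongrightarrow> 0" using assms(6) by (rule tendsto_mult_left_zero)
    then have "\<forall>\<^sub>F n in sequentially. \<alpha> n * M < e / 2"
      by (rule order_tendstoD) (use e in simp)
    then show "\<forall>\<^sub>F n in sequentially.
        (dist (x (Suc n)) p)\<^sup>2 \<le> (1 - \<alpha> n) * (dist (x n) p)\<^sup>2 + \<alpha> n * e"
      using eventually_ge_at_top[of 1]
    proof eventually_elim
      case (elim n)
      have "(dist (x (Suc n)) p)\<^sup>2 \<le> (1 - \<alpha> n) * (dist (x n) p)\<^sup>2 +
          \<alpha> n * ((dist v p)\<^sup>2 - (dist (w k) v)\<^sup>2 + \<alpha> n * M)"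
        unfolding M_def w_def assms(5)[OF elim(2)]
        by (rule halpern_step[OF A p l(1) l(2)[OF elim(2)] _ \<alpha>[OF elim(2)] R[OF elim(2)]]) simp
      also have "\<alpha> n * ((dist v p)\<^sup>2 - (dist (w k) v)\<^sup>2 + \<alpha> n * M) \<le> \<alpha> n * e"
        using k elim \<alpha> by (intro mult_left_mono) auto
      finally show ?case by simp
    qed
  qed (use \<alpha> assms(7) in auto)
  then have "(\<lambda>n. sqrt ((dist (x n) p)\<^sup>2)) \<longlonglongrightarrow> sqrt 0" by (rule tendsto_real_sqrt)
  then have xp: "(\<lambda>n. dist (x n) p) \<longlonglongrightarrow> 0" by simp
  moreover have "(\<lambda>n. dist (z n) p) \<longlonglongrightarrow> 0"
  proof (rule tendsto_sandwich[OF _ _ tendsto_const xp])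
    show "\<forall>\<^sub>F n in sequentially. dist (z n) p \<le> dist (x n) p"
      using eventually_ge_at_top[of 1] by eventually_elim (rule zp)
  qed simp
  ultimately show ?thesis
    unfolding proj z_def by (blast intro: tendsto_dist_iff[THEN iffD2])
qed

end
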